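(* Let $q=p^m$, where $p$ is an odd prime and $m$ is a positive integer, let $\eta$ be the quadratic character of $\mathbb{F}_q$, let $w\in\mathbb{F}_q$ satisfy $\eta(w)=\eta(1+4w)=-1$, and write $\mathbb{F}_q=\{\alpha_1,\ldots,\alpha_{q-1},\alpha_q\}$ with $\alpha_q=0$. Let $\mathcal{C}_w$ be the linear code over $\mathbb{F}_q$ with generator matrix $$G_w=\begin{pmatrix} \alpha_1^2 & \alpha_2^2 & \cdots & \alpha_{q-1}^2 & \alpha_q^2 & 1 & 0 & 1 & 0 & w\\ \alpha_1 & \alpha_2 & \cdots & \alpha_{q-1} & \alpha_q & 0 & 1 & 1 & w & 0\\ 1 & 1 & \cdots & 1 & 1 & 0 & 0 & 0 & -1 & 1\end{pmatrix}.$$ Then $\mathcal{C}_w$ is a $[q+5,3,q+2]$ NMDS code over $\mathbb{F}_q$. Moreover: If $q\equiv 1\pmod 4$, the weight enumerator of $\mathcal{C}_w$ is $$A(z)=1+(2q+2)(q-1)z^{q+2}+\frac{(q-1)(q^2-3q+8)}{2}z^{q+3}+(3q-9)(q-1)z^{q+4}+\frac{(q-1)(q^2-5q+8)}{2}z^{q+5}.$$ If $q\equiv 3\pmod 4$, the weight enumerator of $\mathcal{C}_w$ is $$A(z)=1+(2q+1)(q-1)z^{q+2}+\frac{(q-1)(q^2-3q+14)}{2}z^{q+3}+(3q-12)(q-1)z^{q+4}+\frac{(q-1)(q^2-5q+10)}{2}z^{q+5}.$$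
   Context: An $[n,k,d]$ linear code over $\mathbb{F}_q$ is a $k$-dimensional subspace $\mathcal{C}$ of $\mathbb{F}_q^n$ with minimum nonzero Hamming weight $d$. Its dual $\mathcal{C}^\perp$ is taken with respect to the Euclidean inner product. The Singleton defect of an $[n,k,d]$ code is $s(\mathcal{C})=n-k+1-d$; $\mathcal{C}$ is near maximum distance separable (NMDS) if $s(\mathcal{C})=s(\mathcal{C}^\perp)=1$. The weight enumerator of $\mathcal{C}$ is $A(z)=1+A_1z+\cdots+A_nz^n$, where $A_i$ is the number of codewords of weight $i$. The quadratic character $\eta$ of $\mathbb{F}_q$ ($q$ odd) takes the value $1$ on nonzero squares, $-1$ on nonsquares, and $\eta(0)=0$. *)

theory Defs
  imports
    "Jordan_Normal_Form.DL_Rank"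
    "HOL-Computational_Algebra.Primes"
    "HOL-Computational_Algebra.Polynomial"
begin

definition quad_char :: "'a :: field \<Rightarrow> int" where
  "quad_char x = (if x = 0 then 0 else if \<exists>y. x = y\<^sup>2 then 1 else - 1)"

definition hamming_weight :: "'a :: zero vec \<Rightarrow> nat" where
  "hamming_weight v = card {i. i < dim_vec v \<and> v $ i \<noteq> 0}"

text \<open>\<open>linear_code n k d C\<close> says that \<open>C\<close> is an \<open>[n,k,d]\<close> linear code over the field \<open>'a\<close>.
  In particular \<open>C\<close> is not the zero space, for which no \<open>d\<close> exists.\<close>

definition linear_code :: "nat \<Rightarrow> nat \<Rightarrow> nat \<Rightarrow> 'a :: field vec set \<Rightarrow> bool" where
  "linear_code n k d C \<longleftrightarrow>
     VectorSpace.subspace class_ring C (module_vec TYPE('a) n) \<and>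
     vectorspace.dim class_ring ((module_vec TYPE('a) n)\<lparr>carrier := C\<rparr>) = k \<and>
     (\<exists>c\<in>C. c \<noteq> 0\<^sub>v n \<and> hamming_weight c = d) \<and>
     (\<forall>c\<in>C. c \<noteq> 0\<^sub>v n \<longrightarrow> d \<le> hamming_weight c)"

definition dual_code :: "nat \<Rightarrow> 'a :: field vec set \<Rightarrow> 'a vec set" where
  "dual_code n C = {v \<in> carrier_vec n. \<forall>c\<in>C. v \<bullet> c = 0}"

definition singleton_defect :: "nat \<Rightarrow> nat \<Rightarrow> nat \<Rightarrow> int" where
  "singleton_defect n k d = int n - int k + 1 - int d"

definition nmds :: "nat \<Rightarrow> 'a :: field vec set \<Rightarrow> bool" where
  "nmds n C \<longleftrightarrow>
     (\<exists>k d k' d'. linear_code n k d C \<and> linear_code n k' d' (dual_code n C) \<and>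
        singleton_defect n k d = 1 \<and> singleton_defect n k' d' = 1)"

definition weight_count :: "'a :: field vec set \<Rightarrow> nat \<Rightarrow> nat" where
  "weight_count C i = card {c \<in> C. hamming_weight c = i}"

text \<open>The coefficients are natural numbers; they are taken in \<open>rat\<close> so that closed formulas
  with denominators denote exact division.\<close>

definition weight_enumerator :: "nat \<Rightarrow> 'a :: field vec set \<Rightarrow> rat poly" where
  "weight_enumerator n C = 1 + (\<Sum>i = 1..n. monom (of_nat (weight_count C i)) i)"

text \<open>The enumeration \<open>\<alpha>\<close> of the field is indexed from 1, so column \<open>j\<close> (counted from 0) with
  \<open>j < q\<close> belongs to \<open>\<alpha> (j + 1)\<close>.\<close>

definition gen_matrix :: "nat \<Rightarrow> (nat \<Rightarrow> 'a) \<Rightarrow> 'a :: field \<Rightarrow> 'a mat" where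
  "gen_matrix q \<alpha> w = mat_of_rows_list (q + 5)
     [map (\<lambda>i. (\<alpha> i)\<^sup>2) [1..<q + 1] @ [1, 0, 1,   0, w],
      map (\<lambda>i. \<alpha> i)      [1..<q + 1] @ [0, 1, 1,   w, 0],
      map (\<lambda>i. 1)        [1..<q + 1] @ [0, 0, 0, - 1, 1]]"

definition code_of_matrix :: "nat \<Rightarrow> 'a :: field mat \<Rightarrow> 'a vec set" where
  "code_of_matrix n G = vec_space.row_space n G"

end

(* A codeword is the evaluation of a quadratic a x^2 + b x + c at all field elements, followed by five
   linear forms in (a, b, c), so its weight is q + 5 minus a number of zeros. After scaling a to 1,
   the quadratic has 1 + eta(b^2 - 4 c) roots, and the extra coordinates vanish exactly for b = 0,
   b = -1, c = b w and c = -w. Along the last two lines the discriminant is b (b - 4 w) and b^2 + 4 w;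
   how often it is a square is a count of points on a hyperbola, and only the number of b with
   b^2 + 4 w = 0 depends on q mod 4. The non-square conditions on w and 1 + 4 w
   cap the number of zeros at 3.
   The dual code is handled by counting: its size gives its dimension, and it has minimum weight 3
   since two columns of the generator matrix are never proportional while (1,0,0), (0,1,0), (1,1,0)
   are dependent. *)
theory Submission
  imports Defs
begin

section \<open>Square roots and quadratics over a finite field\<close>

text \<open>When 2 is nonzero this is 1 + \<open>quad_char t\<close>. The count replaces the
  character because it enters directly into numbers of zeros.\<close>

definition num_sqrts :: "'a :: field \<Rightarrow> nat" where
  "num_sqrts t = card {y. y\<^sup>2 = t}"

text \<open>The number of zero coordinates of the codeword with coefficients a, b, c, stated without
  vectors. The five indicators belong to the five extra columns in their order, so
  \<open>b * w = c\<close> is the vanishing of bw - c.\<close>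

definition zero_count :: "'a :: field \<Rightarrow> 'a \<Rightarrow> 'a \<Rightarrow> 'a \<Rightarrow> nat" where
  "zero_count w a b c = card {x. a * x\<^sup>2 + b * x + c = 0} + of_bool (a = 0) + of_bool (b = 0)
     + of_bool (a + b = 0) + of_bool (b * w = c) + of_bool (a * w + c = 0)"

text \<open>In characteristic 2 the map x -> x + 1 is an involution without fixed points, and its
  orbits would partition the field into pairs.\<close>

lemma two_neq_zero_of_odd_card:
  assumes "odd (card (UNIV :: 'a :: {field, finite} set))"
  shows "(2 :: 'a) \<noteq> 0"
proof
  assume "(2 :: 'a) = 0"
  then have two: "x + 1 + 1 = x" for x :: 'a
    by (simp add: add.assoc)
  have "2 * card (range (\<lambda>x :: 'a. {x, x + 1})) = card (\<Union>x :: 'a. {x, x + 1})"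
  proof (rule card_partition)
    fix A B assume "A \<in> range (\<lambda>x :: 'a. {x, x + 1})" "B \<in> range (\<lambda>x :: 'a. {x, x + 1})" "A \<noteq> B"
    then obtain x y where xy: "A = {x, x + 1}" "B = {y, y + 1}" "A \<noteq> B"
      by blast
    have "A = B" if "z \<in> A" "z \<in> B" for z
    proof -
      have "A = {z, z + 1}" "B = {z, z + 1}"
        using that two[of x] two[of y] by (auto simp: xy)
      then show ?thesis by simp
    qed
    with \<open>A \<noteq> B\<close> show "A \<inter> B = {}"
      by blast
  qed auto
  moreover have "(\<Union>x :: 'a. {x, x + 1}) = UNIV"
    by auto
  ultimately show False
    using assms by (metis dvd_triv_left)
qed

lemma num_sqrts_square:
  fixes r :: "'a :: field"
  assumes "(2 :: 'a) \<noteq> 0"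
  shows "num_sqrts (r\<^sup>2) = (if r = 0 then 1 else 2)"
proof -
  have "{y. y\<^sup>2 = r\<^sup>2} = {r, - r}"
    by (auto simp: power2_eq_iff)
  moreover have "r \<noteq> - r" if "r \<noteq> 0"
    using assms that by (metis eq_neg_iff_add_eq_0 mult_2 mult_eq_0_iff)
  ultimately show ?thesis
    by (cases "r = 0") (simp_all add: num_sqrts_def)
qed

lemma num_sqrts_0 [simp]: "num_sqrts (0 :: 'a :: field) = 1"
  by (simp add: num_sqrts_def)

lemma num_sqrts_cases:
  fixes t :: "'a :: field"
  assumes "(2 :: 'a) \<noteq> 0"
  obtains "t = 0" "num_sqrts t = 1" | "t \<noteq> 0" "num_sqrts t = 0" | "t \<noteq> 0" "num_sqrts t = 2"
proof (cases "\<exists>y. t = y\<^sup>2")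
  case True
  then show thesis
    using that num_sqrts_square[OF assms] by (metis zero_eq_power2)
next
  case False
  then have "{y. y\<^sup>2 = t} = {}" by auto
  then have "num_sqrts t = 0" by (simp add: num_sqrts_def)
  moreover from False have "t \<noteq> 0" by (metis zero_power2)
  ultimately show thesis using that by blast
qed

lemma num_sqrts_eq_0_if_quad_char:
  assumes "quad_char t = - 1"
  shows "num_sqrts t = 0"
proof -
  have "\<nexists>y. t = y\<^sup>2"
    using assms by (auto simp: quad_char_def split: if_splits)
  then have "{y. y\<^sup>2 = t} = {}" by auto
  then show ?thesis by (simp add: num_sqrts_def)
qed

lemma num_sqrts_mult_square:
  fixes k t :: "'a :: field"
  assumes "k \<noteq> 0"
  shows "num_sqrts (k\<^sup>2 * t) = num_sqrts t"
proof -
  have "bij_betw ((*) k) {y. y\<^sup>2 = t} {y. y\<^sup>2 = k\<^sup>2 * t}"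
    by (rule bij_betw_byWitness[where f' = "\<lambda>y. y / k"])
       (use assms in \<open>auto simp: power_mult_distrib power_divide\<close>)
  then show ?thesis
    by (simp add: num_sqrts_def bij_betw_same_card)
qed

text \<open>Completing the square: 4 (x^2 + b x + c) = (2 x + b)^2 - (b^2 - 4 c), and x -> 2 x + b
  is a bijection from the roots to the square roots of the discriminant.\<close>

lemma card_roots_monic_quadratic:
  fixes b c :: "'a :: field"
  assumes "(2 :: 'a) \<noteq> 0"
  shows "card {x. x\<^sup>2 + b * x + c = 0} = num_sqrts (b\<^sup>2 - 4 * c)"
proof -
  have eq: "(2 * x + b)\<^sup>2 = b\<^sup>2 - 4 * c \<longleftrightarrow> x\<^sup>2 + b * x + c = 0" for x
  proof -
    have "(2 * x + b)\<^sup>2 - (b\<^sup>2 - 4 * c) = 2 * 2 * (x\<^sup>2 + b * x + c)"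
      by (simp add: power2_eq_square algebra_simps)
    then show ?thesis
      using assms by (metis eq_iff_diff_eq_0 mult_eq_0_iff)
  qed
  have eq2: "2 * ((y - b) / 2) + b = y" for y
    using assms by (metis diff_add_cancel nonzero_mult_div_cancel_left times_divide_eq_right)
  have "bij_betw (\<lambda>x. 2 * x + b) {x. x\<^sup>2 + b * x + c = 0} {y. y\<^sup>2 = b\<^sup>2 - 4 * c}"
  proof (rule bij_betw_byWitness[where f' = "\<lambda>y. (y - b) / 2"])
    show "(\<lambda>y. (y - b) / 2) ` {y. y\<^sup>2 = b\<^sup>2 - 4 * c} \<subseteq> {x. x\<^sup>2 + b * x + c = 0}"
      by (simp only: image_subset_iff mem_Collect_eq eq[symmetric] eq2 Ball_def simp_thms)
    show "\<forall>x\<in>{x. x\<^sup>2 + b * x + c = 0}. (2 * x + b - b) / 2 = x"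
      using assms by simp
    show "\<forall>y\<in>{y. y\<^sup>2 = b\<^sup>2 - 4 * c}. 2 * ((y - b) / 2) + b = y"
      by (simp only: eq2 Ball_def simp_thms)
    show "(\<lambda>x. 2 * x + b) ` {x. x\<^sup>2 + b * x + c = 0} \<subseteq> {y. y\<^sup>2 = b\<^sup>2 - 4 * c}"
      by (simp only: image_subset_iff mem_Collect_eq eq Ball_def simp_thms)
  qed
  then show ?thesis
    by (simp add: num_sqrts_def bij_betw_same_card)
qed

section \<open>Sums of numbers of square roots\<close>

lemma sum_num_sqrts:
  fixes f :: "'a :: {field, finite} \<Rightarrow> int"
  shows "(\<Sum>t\<in>UNIV. int (num_sqrts t) * f t) = (\<Sum>y\<in>UNIV. f (y\<^sup>2))"
proof -
  \<comment> \<open>Group the elements y by their square t.\<close>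
  have "(\<Sum>y\<in>UNIV. f (y\<^sup>2)) = (\<Sum>t\<in>UNIV. \<Sum>y\<in>{y. y \<in> UNIV \<and> y\<^sup>2 = t}. f (y\<^sup>2))"
    by (rule sum.group[symmetric]) auto
  also have "\<dots> = (\<Sum>t\<in>UNIV. int (num_sqrts t) * f t)"
    by (rule sum.cong) (simp_all add: num_sqrts_def)
  finally show ?thesis by simp
qed

lemma card_hyperbola:
  fixes k :: "'a :: {field, finite}"
  assumes "k \<noteq> 0"
  shows "card {(u, v). u * v = k} = card (UNIV :: 'a set) - 1"
proof -
  have "bij_betw (\<lambda>u. (u, k / u)) (UNIV - {0}) {(u, v). u * v = k}"
    by (rule bij_betw_byWitness[where f' = fst]) (use assms in \<open>auto simp: field_simps\<close>)
  then show ?thesis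
    by (simp add: bij_betw_same_card[symmetric] card_Diff_singleton)
qed

text \<open>The sum counts the pairs (b, y) with y^2 - (b - s)^2 = k. Factoring the left side as u v
  with u = y - (b - s) and v = y + (b - s) turns them into the points of the hyperbola u v =
  k.\<close>

lemma sum_num_sqrts_quadratic:
  fixes s k :: "'a :: {field, finite}"
  assumes two: "(2 :: 'a) \<noteq> 0" and "k \<noteq> 0"
  shows "(\<Sum>b\<in>UNIV. int (num_sqrts ((b - s)\<^sup>2 + k))) = int (card (UNIV :: 'a set)) - 1"
proof -
  have "(\<Sum>b\<in>UNIV. num_sqrts ((b - s)\<^sup>2 + k)) = card (SIGMA b:UNIV. {y. y\<^sup>2 = (b - s)\<^sup>2 + k})"
    by (subst card_SigmaI) (auto simp: num_sqrts_def)
  also have "bij_betw (\<lambda>(b, y). (y - (b - s), y + (b - s)))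
      (SIGMA b:UNIV. {y. y\<^sup>2 = (b - s)\<^sup>2 + k}) {(u, v). u * v = k}"
  proof (rule bij_betw_byWitness[where f' = "\<lambda>(u, v). ((v - u) / 2 + s, (u + v) / 2)"])
    have "(y + (b - s) - (y - (b - s))) / 2 + s = b \<and> (y - (b - s) + (y + (b - s))) / 2 = y" for b y
    proof -
      have "y + (b - s) - (y - (b - s)) = (b - s) * 2" "y - (b - s) + (y + (b - s)) = y * 2"
        by (simp_all add: algebra_simps)
      then show ?thesis
        using two by (simp only: nonzero_mult_div_cancel_right not_False_eq_True diff_add_cancel)
    qed
    then show "\<forall>p\<in>SIGMA b:UNIV. {y. y\<^sup>2 = (b - s)\<^sup>2 + k}.
      (case case p of (b, y) \<Rightarrow> (y - (b - s), y + (b - s)) of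
        (u, v) \<Rightarrow> ((v - u) / 2 + s, (u + v) / 2)) = p"
      by (simp only: Ball_def split_paired_All prod.case mem_Sigma_iff mem_Collect_eq simp_thms)
    show "(\<lambda>(b, y). (y - (b - s), y + (b - s))) ` (SIGMA b:UNIV. {y. y\<^sup>2 = (b - s)\<^sup>2 + k}) \<subseteq> {(u, v). u * v = k}"
      by (auto simp: power2_eq_square algebra_simps)
  next
    have four: "(4 :: 'a) \<noteq> 0"
      using two by (metis mult_2 mult_eq_0_iff numeral_Bit0)
    have "(u + v) / 2 - (v - u) / 2 = u \<and> (u + v) / 2 + (v - u) / 2 = v" for u v :: 'a
      using two four by (simp add: field_simps)
    then show "\<forall>p\<in>{(u, v). u * v = k}.
      (case case p of (u, v) \<Rightarrow> ((v - u) / 2 + s, (u + v) / 2) of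
        (b, y) \<Rightarrow> (y - (b - s), y + (b - s))) = p"
      by (simp only: Ball_def split_paired_All prod.case mem_Sigma_iff mem_Collect_eq simp_thms add_diff_cancel)
    have "((u + v) / 2)\<^sup>2 = ((v - u) / 2)\<^sup>2 + u * v" for u v :: 'a
      using two four by (simp add: power2_eq_square field_simps)
    then show "(\<lambda>(u, v). ((v - u) / 2 + s, (u + v) / 2)) ` {(u, v). u * v = k} \<subseteq> (SIGMA b:UNIV. {y. y\<^sup>2 = (b - s)\<^sup>2 + k})"
      by auto
  qed
  then have "card (SIGMA b:UNIV. {y. y\<^sup>2 = (b - s)\<^sup>2 + k}) = card {(u, v). u * v = k}"
    by (rule bij_betw_same_card)
  finally have "(\<Sum>b\<in>UNIV. num_sqrts ((b - s)\<^sup>2 + k)) = card (UNIV :: 'a set) - 1"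
    using card_hyperbola[OF \<open>k \<noteq> 0\<close>] by simp
  moreover have "card (UNIV :: 'a set) > 0"
    by (simp add: card_gt_0_iff)
  ultimately show ?thesis
    by (simp flip: of_nat_sum)
qed

text \<open>Since \<open>num_sqrts\<close> only takes the values 0, 1 and 2, how often each of them occurs is determined
  by the number of zeros and by the sum.\<close>

lemma sum_comp_num_sqrts:
  fixes g :: "'b \<Rightarrow> 'a :: field" and F :: "nat \<Rightarrow> int"
  assumes two: "(2 :: 'a) \<noteq> 0" and "finite B"
    and n: "int (card {b \<in> B. g b = 0}) = n" and S: "(\<Sum>b\<in>B. int (num_sqrts (g b))) = S"
  shows "2 * (\<Sum>b\<in>B. F (num_sqrts (g b)))
    = (2 * int (card B) - n - S) * F 0 + 2 * n * F 1 + (S - n) * F 2"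
proof -
  \<comment> \<open>The three coefficients are twice the indicators of \<open>num_sqrts t\<close>
    being 0, 1 and 2, and they are linear in \<open>of_bool (t = 0)\<close> and
    \<open>num_sqrts t\<close>, so they can be summed.\<close>
  have "2 * F (num_sqrts t) = (2 - of_bool (t = 0) - int (num_sqrts t)) * F 0
      + 2 * of_bool (t = 0) * F 1 + (int (num_sqrts t) - of_bool (t = 0)) * F 2" for t :: 'a
    by (cases t rule: num_sqrts_cases[OF two]) (simp_all add: numeral_2_eq_2)
  then have "2 * (\<Sum>b\<in>B. F (num_sqrts (g b)))
     = (\<Sum>b\<in>B. (2 - of_bool (g b = 0) - int (num_sqrts (g b))) * F 0
      + 2 * of_bool (g b = 0) * F 1 + (int (num_sqrts (g b)) - of_bool (g b = 0)) * F 2)"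
    by (simp add: sum_distrib_left)
  moreover have "(\<Sum>b\<in>B. of_bool (g b = 0)) = n"
    using n \<open>finite B\<close> by (simp add: sum.If_cases of_bool_def Int_def conj_commute)
  ultimately show ?thesis
    using S by (simp add: sum.distrib sum_subtractf flip: sum_distrib_right sum_distrib_left)
qed

text \<open>Only the summand at s changes. For fixed b this accounts for an extra coordinate that
  vanishes at a single value of c.\<close>

lemma sum_add_of_bool:
  fixes h :: "'a \<Rightarrow> nat" and F :: "nat \<Rightarrow> int"
  assumes "finite A" "s \<in> A"
  shows "(\<Sum>c\<in>A. F (h c + of_bool (c = s) * k)) = (\<Sum>c\<in>A. F (h c)) + F (h s + k) - F (h s)"
proof -
  have "(\<Sum>c\<in>A. F (h c + of_bool (c = s) * k)) - (\<Sum>c\<in>A. F (h c))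
     = (\<Sum>c\<in>A. if c = s then F (h s + k) - F (h s) else 0)"
    unfolding sum_subtractf[symmetric] by (rule sum.cong) auto
  then show ?thesis
    using assms by simp
qed

section \<open>The distribution of the number of zeros\<close>

text \<open>As c runs over the field, the discriminant d - 4 c takes each value once. The weight
  function F stays arbitrary here and below; it becomes the indicator of one number of zeros at the
  end, and its shift by \<open>Suc\<close> is needed on the way.\<close>

lemma sum_num_sqrts_affine:
  fixes d :: "'a :: {field, finite}" and F :: "nat \<Rightarrow> int"
  assumes two: "(2 :: 'a) \<noteq> 0"
  shows "2 * (\<Sum>c\<in>UNIV. F (num_sqrts (d - 4 * c)))
    = (int (card (UNIV :: 'a set)) - 1) * F 0 + 2 * F 1 + (int (card (UNIV :: 'a set)) - 1) * F 2"
proof -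
  have four: "(4 :: 'a) \<noteq> 0"
    using two by (metis mult_2 mult_eq_0_iff numeral_Bit0)
  have "bij (\<lambda>c. d - 4 * c)"
    by (rule bij_betw_byWitness[where f' = "\<lambda>t. (d - t) / 4"]) (use four in \<open>auto simp del: right_diff_distrib_numeral\<close>)
  then have "(\<Sum>c\<in>UNIV. F (num_sqrts (d - 4 * c))) = (\<Sum>t\<in>UNIV. F (num_sqrts (t :: 'a)))"
    by (rule sum.reindex_bij_betw)
  \<comment> \<open>The identity function has one zero, and its numbers of square roots add up to q
    since every y is a square root of exactly one t.\<close>
  moreover have "2 * (\<Sum>t\<in>UNIV. F (num_sqrts (t :: 'a)))
     = (2 * int (card (UNIV :: 'a set)) - 1 - int (card (UNIV :: 'a set))) * F 0 + 2 * 1 * F 1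
       + (int (card (UNIV :: 'a set)) - 1) * F 2"
    by (rule sum_comp_num_sqrts[OF two]) (use sum_num_sqrts[of "\<lambda>_. 1"] in auto)
  ultimately show ?thesis by simp
qed

text \<open>Counting the solutions of \<open>y\<^sup>2 = b\<^sup>2 + 4 * w\<close>: apart from those with \<open>y = 0\<close> they come in
  quadruples \<open>(\<plusminus>b, \<plusminus>y)\<close>, since there are none with \<open>b = 0\<close>. In this way \<open>q mod 4\<close> enters.\<close>

lemma num_sqrts_uminus_cong:
  fixes w :: "'a :: {field, finite}"
  assumes two: "(2 :: 'a) \<noteq> 0" and w: "num_sqrts w = 0"
  shows "4 dvd int (card (UNIV :: 'a set)) - 1 - int (num_sqrts (- w))"
proof -
  have four: "num_sqrts (4 * t) = num_sqrts t" for t :: 'a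
    using num_sqrts_mult_square[OF two, of t] by (simp add: power2_eq_square)
  have w0: "w \<noteq> 0" using w by auto
  have four0: "(4 :: 'a) \<noteq> 0"
    using two by (metis mult_2 mult_eq_0_iff numeral_Bit0)
  \<comment> \<open>Here t stands for b^2: the weight \<open>num_sqrts t\<close> counts the choices
    of b, the other factor those of y.\<close>
  have "(\<Sum>t\<in>UNIV. int (num_sqrts t) * int (num_sqrts (t + 4 * w))) = int (card (UNIV :: 'a set)) - 1"
    using sum_num_sqrts_quadratic[OF two, of "4 * w" 0] four0 w0 by (simp add: sum_num_sqrts)
  moreover have "(\<Sum>t\<in>UNIV. of_bool (t = - (4 * w)) * int (num_sqrts (- w))) = int (num_sqrts (- w))"
    by (simp add: of_bool_def if_distrib[of "\<lambda>x. x * _"] cong: if_cong)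
  \<comment> \<open>The term at t = -4w cancels exactly. Elsewhere each factor is 0 or 2, except
    that t = 0 has a single root; there the other factor is \<open>num_sqrts (4 * w)\<close>, which
    is 0. So each remaining product is 0 or 4.\<close>
  moreover have "4 dvd (\<Sum>t\<in>UNIV. int (num_sqrts t) * int (num_sqrts (t + 4 * w))
      - of_bool (t = - (4 * w)) * int (num_sqrts (- w)))"
  proof (rule dvd_sum)
    fix t :: 'a
    show "4 dvd int (num_sqrts t) * int (num_sqrts (t + 4 * w))
      - of_bool (t = - (4 * w)) * int (num_sqrts (- w))"
    proof (cases "t = - (4 * w)")
      case True
      then show ?thesis using four[of "- w"] by simp
    next
      case False
      then have "t + 4 * w \<noteq> 0" by (simp add: eq_neg_iff_add_eq_0)
      moreover have "num_sqrts (t + 4 * w) = 0" if "t = 0"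
        using that four[of w] w by simp
      ultimately show ?thesis
        using False
        by (cases t rule: num_sqrts_cases[OF two]; cases "t + 4 * w" rule: num_sqrts_cases[OF two]) auto
    qed
  qed
  ultimately show ?thesis
    by (simp add: sum_subtractf)
qed

text \<open>The value is 0 or 2 because -w is nonzero, and the congruence mod 4 decides between the
  two. In terms of the character this says eta(-w) = -eta(-1).\<close>

lemma num_sqrts_uminus:
  fixes w :: "'a :: {field, finite}"
  assumes two: "(2 :: 'a) \<noteq> 0" and w: "num_sqrts w = 0"
  shows "card (UNIV :: 'a set) mod 4 = 1 \<Longrightarrow> num_sqrts (- w) = 0"
    and "card (UNIV :: 'a set) mod 4 = 3 \<Longrightarrow> num_sqrts (- w) = 2"
proof -
  have "- w \<noteq> 0" using w by auto
  then have "num_sqrts (- w) = 0 \<or> num_sqrts (- w) = 2"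
    by (cases "- w" rule: num_sqrts_cases[OF two]) auto
  then show "card (UNIV :: 'a set) mod 4 = 1 \<Longrightarrow> num_sqrts (- w) = 0"
    and "card (UNIV :: 'a set) mod 4 = 3 \<Longrightarrow> num_sqrts (- w) = 2"
    using num_sqrts_uminus_cong[OF assms] by presburger+
qed

section \<open>Numbers of zeros over all coefficient triples, starting from the monic
  quadratics\<close>

lemma zero_count_scale:
  fixes k :: "'a :: field"
  assumes "k \<noteq> 0"
  shows "zero_count w (k * a) (k * b) (k * c) = zero_count w a b c"
proof -
  have "k * a * x\<^sup>2 + k * b * x + k * c = k * (a * x\<^sup>2 + b * x + c)"
    "k * a + k * b = k * (a + b)" "k * a * w + k * c = k * (a * w + c)" for x
    by (simp_all add: algebra_simps)
  then show ?thesis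
    using assms by (simp add: zero_count_def mult.assoc)
qed

lemma zero_count_monic:
  fixes b c w :: "'a :: field"
  assumes "(2 :: 'a) \<noteq> 0"
  shows "zero_count w 1 b c = num_sqrts (b\<^sup>2 - 4 * c) + of_bool (b = 0) + of_bool (b = - 1)
     + of_bool (c = b * w) + of_bool (c = - w)"
proof -
  have "1 + b = 0 \<longleftrightarrow> b = - 1" "w + c = 0 \<longleftrightarrow> c = - w" "b * w = c \<longleftrightarrow> c = b * w"
    by (auto simp: add_eq_0_iff)
  then show ?thesis
    using card_roots_monic_quadratic[OF assms, of b c] by (simp add: zero_count_def)
qed

text \<open>For generic b only the coordinates for c = bw and c = -w can add zeros, and these values
  differ since b is not -1. At each of them F(N) becomes F(N + 1), where N counts the roots for the
  discriminant there. Both discriminants are written as \<open>(b - s)\<^sup>2 + k\<close>, with s =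
  0 in the second, to fit \<open>sum_num_sqrts_quadratic\<close>.\<close>

lemma sum_zero_count_monic_fixed:
  fixes b w :: "'a :: {field, finite}" and F :: "nat \<Rightarrow> int"
  defines "q \<equiv> int (card (UNIV :: 'a set))"
  assumes two: "(2 :: 'a) \<noteq> 0" and w: "num_sqrts w = 0" and b: "b \<noteq> 0" "b \<noteq> - 1"
  shows "2 * (\<Sum>c\<in>UNIV. F (zero_count w 1 b c))
    = (q - 1) * F 0 + 2 * F 1 + (q - 1) * F 2
      + 2 * (F (num_sqrts ((b - 2 * w)\<^sup>2 + - (4 * w\<^sup>2)) + 1) - F (num_sqrts ((b - 2 * w)\<^sup>2 + - (4 * w\<^sup>2))))
      + 2 * (F (num_sqrts ((b - 0)\<^sup>2 + 4 * w) + 1) - F (num_sqrts ((b - 0)\<^sup>2 + 4 * w)))"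
proof -
  have w0: "w \<noteq> 0" using w by auto
  then have bw: "- w \<noteq> b * w"
    using b by (metis mult_cancel_right mult_minus1)
  have sq: "b\<^sup>2 - 4 * (b * w) = (b - 2 * w)\<^sup>2 + - (4 * w\<^sup>2)" "b\<^sup>2 - 4 * (- w) = (b - 0)\<^sup>2 + 4 * w"
    by (simp_all add: power2_eq_square algebra_simps)
  have "(\<Sum>c\<in>UNIV. F (zero_count w 1 b c))
     = (\<Sum>c\<in>UNIV. F ((num_sqrts (b\<^sup>2 - 4 * c) + of_bool (c = b * w) * 1) + of_bool (c = - w) * 1))"
    using b by (simp add: zero_count_monic[OF two])
  also have "\<dots> = (\<Sum>c\<in>UNIV. F (num_sqrts (b\<^sup>2 - 4 * c)))
      + F (num_sqrts (b\<^sup>2 - 4 * (b * w)) + 1) - F (num_sqrts (b\<^sup>2 - 4 * (b * w)))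
      + F (num_sqrts (b\<^sup>2 - 4 * (- w)) + 1) - F (num_sqrts (b\<^sup>2 - 4 * (- w)))"
    using bw by (subst sum_add_of_bool, simp, simp, subst sum_add_of_bool) simp_all
  finally show ?thesis
    using sum_num_sqrts_affine[OF two, of F "b\<^sup>2"] unfolding sq q_def by (simp add: algebra_simps)
qed

text \<open>For b = 0 one extra coordinate always vanishes, hence the \<open>Suc\<close>. At c = 0
  the double root gives three zeros instead of two; at c = -w the discriminant 4w is a nonsquare,
  which gives two zeros instead of one.\<close>

lemma sum_zero_count_monic_0:
  fixes w :: "'a :: {field, finite}" and F :: "nat \<Rightarrow> int"
  defines "q \<equiv> int (card (UNIV :: 'a set))"
  assumes two: "(2 :: 'a) \<noteq> 0" and w: "num_sqrts w = 0"
  shows "2 * (\<Sum>c\<in>UNIV. F (zero_count w 1 0 c)) = (q - 3) * F 1 + 2 * F 2 + (q + 1) * F 3"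
proof -
  have w0: "w \<noteq> 0" using w by auto
  have four: "num_sqrts (4 * w) = 0"
    using num_sqrts_mult_square[OF two, of w] w by (simp add: power2_eq_square)
  have "(\<Sum>c\<in>UNIV. F (zero_count w 1 0 c))
     = (\<Sum>c\<in>UNIV. F (Suc (num_sqrts (0 - 4 * c) + of_bool (c = 0) * 1) + of_bool (c = - w) * 1))"
    by (simp add: zero_count_monic[OF two])
  also have "\<dots> = (\<Sum>c\<in>UNIV. F (Suc (num_sqrts (0 - 4 * (c :: 'a))))) + F 3 - F 2 + F 2 - F 1"
    using w0 four
    by (subst sum_add_of_bool, simp, simp, subst sum_add_of_bool[where F = "\<lambda>x. F (Suc x)"])
      (simp_all add: eval_nat_numeral)
  finally show ?thesis
    using sum_num_sqrts_affine[OF two, of "\<lambda>x. F (Suc x)" 0] unfolding q_def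
    by (simp add: algebra_simps eval_nat_numeral)
qed

text \<open>For b = -1 the values bw and -w coincide, so two zeros are added at once. The
  discriminant there is the nonsquare 1 + 4w, so the total is 3.\<close>

lemma sum_zero_count_monic_minus_1:
  fixes w :: "'a :: {field, finite}" and F :: "nat \<Rightarrow> int"
  defines "q \<equiv> int (card (UNIV :: 'a set))"
  assumes two: "(2 :: 'a) \<noteq> 0" and w: "num_sqrts (1 + 4 * w) = 0"
  shows "2 * (\<Sum>c\<in>UNIV. F (zero_count w 1 (- 1) c)) = (q - 3) * F 1 + 2 * F 2 + (q + 1) * F 3"
proof -
  have "(\<Sum>c\<in>UNIV. F (zero_count w 1 (- 1) c))
     = (\<Sum>c\<in>UNIV. F (Suc (num_sqrts (1 - 4 * c)) + of_bool (c = - w) * 2))"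
    by (rule sum.cong) (simp_all add: zero_count_monic[OF two])
  also have "\<dots> = (\<Sum>c\<in>UNIV. F (Suc (num_sqrts (1 - 4 * (c :: 'a))))) + F 3 - F 1"
    using w by (subst sum_add_of_bool) (simp_all add: eval_nat_numeral)
  finally show ?thesis
    using sum_num_sqrts_affine[OF two, of "\<lambda>x. F (Suc x)" 1] unfolding q_def
    by (simp add: algebra_simps eval_nat_numeral)
qed

text \<open>The values b = 0 and b = -1 are treated separately. On the remaining set B the
  distribution of each discriminant \<open>g1\<close>, \<open>g2\<close> follows from its number of
  zeros and its sum of square root counts.\<close>

lemma sum_zero_count_monic:
  fixes w :: "'a :: {field, finite}" and F :: "nat \<Rightarrow> int"
  defines "q \<equiv> int (card (UNIV :: 'a set))" and "n \<equiv> int (num_sqrts (- w))"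
  assumes two: "(2 :: 'a) \<noteq> 0" and w: "num_sqrts w = 0" and w1: "num_sqrts (1 + 4 * w) = 0"
  shows "2 * (\<Sum>b\<in>UNIV. \<Sum>c\<in>UNIV. F (zero_count w 1 b c))
    = (q\<^sup>2 - 5 * q + 8 + n) * F 0 + (6 * q - 18 - 3 * n) * F 1 + (q\<^sup>2 - 5 * q + 12 + 3 * n) * F 2
      + (4 * q - 2 - n) * F 3"
proof -
  define B where "B = UNIV - {0, - 1 :: 'a}"
  define g1 g2 :: "'a \<Rightarrow> 'a" where "g1 b = (b - 2 * w)\<^sup>2 + - (4 * w\<^sup>2)" and "g2 b = (b - 0)\<^sup>2 + 4 * w" for b
  have w0: "w \<noteq> 0" using w by auto
  have four: "(4 :: 'a) \<noteq> 0"
    using two by (metis mult_2 mult_eq_0_iff numeral_Bit0)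
  have num_four: "num_sqrts (4 * t) = num_sqrts t" for t :: 'a
    using num_sqrts_mult_square[OF two, of t] by (simp add: power2_eq_square)
  have split: "(\<Sum>b\<in>UNIV. f b) = f 0 + f (- 1) + (\<Sum>b\<in>B. f b)" for f :: "'a \<Rightarrow> int"
  proof -
    have "(\<Sum>b\<in>UNIV. f b) = (\<Sum>b\<in>{0, - 1}. f b) + (\<Sum>b\<in>B. f b)"
      unfolding B_def by (subst add.commute, rule sum.subset_diff) auto
    then show ?thesis by simp
  qed
  have card_B: "int (card B) = q - 2"
    using split[of "\<lambda>_. 1"] by (simp add: q_def)
  have g1_eq: "g1 b = b * (b - 4 * w)" for b
    by (simp add: g1_def power2_eq_square algebra_simps)
  have nonzero: "1 + 4 * w \<noteq> 0"
    using w1 by (metis num_sqrts_0 zero_neq_one)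
  have "(\<Sum>b\<in>UNIV. int (num_sqrts (g1 b))) = q - 1" "(\<Sum>b\<in>UNIV. int (num_sqrts (g2 b))) = q - 1"
    unfolding g1_def g2_def q_def by (rule sum_num_sqrts_quadratic[OF two], use w0 four in simp)+
  moreover have g_vals: "g1 0 = 0" "g1 (- 1) = 1 + 4 * w" "g2 0 = 4 * w" "g2 (- 1) = 1 + 4 * w"
    by (simp_all add: g1_eq g2_def)
  \<comment> \<open>Leaving out 0 and -1 removes only the single square root of \<open>g1 0\<close>
    = 0; the other three omitted values are nonsquares.\<close>
  ultimately have S1: "(\<Sum>b\<in>B. int (num_sqrts (g1 b))) = q - 2"
    and S2: "(\<Sum>b\<in>B. int (num_sqrts (g2 b))) = q - 1"
    using split[of "\<lambda>b. int (num_sqrts (g1 b))"] split[of "\<lambda>b. int (num_sqrts (g2 b))"]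
      w w1 num_four[of w] by simp_all
  \<comment> \<open>The root b = 0 lies outside B, while 4w lies in B because w and 1 + 4w are
    nonzero.\<close>
  have "{b \<in> B. g1 b = 0} = {4 * w}"
    using w0 four nonzero by (auto simp: B_def g1_eq eq_neg_iff_add_eq_0 add.commute)
  then have n1: "int (card {b \<in> B. g1 b = 0}) = 1" by simp
  have "b \<in> B" if "g2 b = 0" for b
    using that w0 four nonzero g_vals(3,4) by (auto simp: B_def)
  then have "{b \<in> B. g2 b = 0} = {y. y\<^sup>2 = 4 * (- w)}"
    by (auto simp: g2_def eq_neg_iff_add_eq_0)
  then have n2: "int (card {b \<in> B. g2 b = 0}) = n"
    using num_four[of "- w"] by (simp add: n_def num_sqrts_def)
  have "2 * (\<Sum>b\<in>B. \<Sum>c\<in>UNIV. F (zero_count w 1 b c)) = (\<Sum>b\<in>B. 2 * (\<Sum>c\<in>UNIV. F (zero_count w 1 b c)))"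
    by (rule sum_distrib_left)
  also have "\<dots> = (\<Sum>b\<in>B. (q - 1) * F 0 + 2 * F 1 + (q - 1) * F 2
      + 2 * (F (Suc (num_sqrts (g1 b))) - F (num_sqrts (g1 b)))
      + 2 * (F (Suc (num_sqrts (g2 b))) - F (num_sqrts (g2 b))))"
    unfolding g1_def g2_def q_def
    by (rule sum.cong[OF refl], subst sum_zero_count_monic_fixed[OF two w]) (simp_all add: B_def)
  also have "\<dots> = (q - 2) * ((q - 1) * F 0 + 2 * F 1 + (q - 1) * F 2)
      + 2 * (\<Sum>b\<in>B. F (Suc (num_sqrts (g1 b)))) - 2 * (\<Sum>b\<in>B. F (num_sqrts (g1 b)))
      + 2 * (\<Sum>b\<in>B. F (Suc (num_sqrts (g2 b)))) - 2 * (\<Sum>b\<in>B. F (num_sqrts (g2 b)))"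
    by (simp add: sum.distrib sum_subtractf card_B algebra_simps flip: sum_distrib_left)
  finally have "2 * (\<Sum>b\<in>B. \<Sum>c\<in>UNIV. F (zero_count w 1 b c)) = \<dots>" .
  \<comment> \<open>For each discriminant the interpolation is used twice, for F and for its shift
    by \<open>Suc\<close>, to evaluate the differences F(N + 1) - F(N).\<close>
  then show ?thesis
    using split[of "\<lambda>b. \<Sum>c\<in>UNIV. F (zero_count w 1 b c)"]
      sum_zero_count_monic_0[OF two w, of F, folded q_def]
      sum_zero_count_monic_minus_1[OF two w1, of F, folded q_def]
      sum_comp_num_sqrts[OF two _ n1 S1, of F] sum_comp_num_sqrts[OF two _ n1 S1, of "\<lambda>x. F (Suc x)"]
      sum_comp_num_sqrts[OF two _ n2 S2, of F] sum_comp_num_sqrts[OF two _ n2 S2, of "\<lambda>x. F (Suc x)"]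
    by (simp add: card_B algebra_simps power2_eq_square eval_nat_numeral)
qed

text \<open>Scaling leaves the number of zeros unchanged, so the triples with a nonzero reduce to a
  = 1, and those with a = 0 and b nonzero to b = 1. The zero triple supplies the term
  \<open>F (q + 5)\<close>.\<close>

lemma sum_zero_count:
  fixes w :: "'a :: {field, finite}" and F :: "nat \<Rightarrow> int"
  defines "q \<equiv> card (UNIV :: 'a set)" and "n \<equiv> int (num_sqrts (- w))"
  assumes two: "(2 :: 'a) \<noteq> 0" and w: "num_sqrts w = 0" and w1: "num_sqrts (1 + 4 * w) = 0"
  shows "2 * (\<Sum>a\<in>UNIV. \<Sum>b\<in>UNIV. \<Sum>c\<in>UNIV. F (zero_count w a b c))
    = 2 * F (q + 5) + (int q - 1) * ((int q ^ 2 - 5 * int q + 8 + n) * F 0 + (6 * int q - 18 - 3 * n) * F 1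
       + (int q ^ 2 - 3 * int q + 8 + 3 * n) * F 2 + (4 * int q + 4 - n) * F 3)"
proof -
  have w0: "w \<noteq> 0" using w by auto
  have "q > 0" by (simp add: q_def card_gt_0_iff)
  then have card: "int (card (UNIV - {0 :: 'a})) = int q - 1"
    by (simp add: card_Diff_singleton q_def of_nat_diff)
  have split: "(\<Sum>x\<in>UNIV. f x) = f 0 + (int q - 1) * f 1"
    if "\<And>x. x \<noteq> 0 \<Longrightarrow> f x = f 1" for f :: "'a \<Rightarrow> int"
  proof -
    have "(\<Sum>x\<in>UNIV. f x) = f 0 + (\<Sum>x\<in>UNIV - {0}. f x)"
      by (simp add: sum.remove)
    also have "(\<Sum>x\<in>UNIV - {0}. f x) = (\<Sum>x\<in>UNIV - {0 :: 'a}. f 1)"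
      by (rule sum.cong[OF refl], rule that) simp
    also have "\<dots> = (int q - 1) * f 1"
      by (simp only: sum_constant card)
    finally show ?thesis .
  qed
  have scale: "(\<Sum>x\<in>UNIV. f x) = (\<Sum>x\<in>UNIV. f (k * x))" if "k \<noteq> 0" for k :: 'a and f :: "'a \<Rightarrow> int"
  proof (rule sum.reindex_bij_betw[symmetric])
    show "bij ((*) k)"
      by (rule bij_betw_byWitness[where f' = "\<lambda>x. x / k"]) (use that in auto)
  qed
  have "(\<Sum>b\<in>UNIV. \<Sum>c\<in>UNIV. F (zero_count w a b c)) = (\<Sum>b\<in>UNIV. \<Sum>c\<in>UNIV. F (zero_count w 1 b c))"
    if "a \<noteq> 0" for a
  proof -
    have "(\<Sum>b\<in>UNIV. \<Sum>c\<in>UNIV. F (zero_count w a b c)) = (\<Sum>b\<in>UNIV. \<Sum>c\<in>UNIV. F (zero_count w a (a * b) c))"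
      by (rule scale[OF that])
    also have "\<dots> = (\<Sum>b\<in>UNIV. \<Sum>c\<in>UNIV. F (zero_count w a (a * b) (a * c)))"
      by (rule sum.cong[OF refl], rule scale[OF that])
    finally show ?thesis
      using zero_count_scale[OF that, of w 1] by simp
  qed
  then have a: "(\<Sum>a\<in>UNIV. \<Sum>b\<in>UNIV. \<Sum>c\<in>UNIV. F (zero_count w a b c))
      = (\<Sum>b\<in>UNIV. \<Sum>c\<in>UNIV. F (zero_count w 0 b c)) + (int q - 1) * (\<Sum>b\<in>UNIV. \<Sum>c\<in>UNIV. F (zero_count w 1 b c))"
    by (rule split)
  have "(\<Sum>c\<in>UNIV. F (zero_count w 0 b c)) = (\<Sum>c\<in>UNIV. F (zero_count w 0 1 c))"
    if "b \<noteq> 0" for b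
    using zero_count_scale[OF that, of w 0 1]
    by (subst scale[OF that]) simp
  then have b: "(\<Sum>b\<in>UNIV. \<Sum>c\<in>UNIV. F (zero_count w 0 b c))
      = (\<Sum>c\<in>UNIV. F (zero_count w 0 0 c)) + (int q - 1) * (\<Sum>c\<in>UNIV. F (zero_count w 0 1 c))"
    by (rule split)
  have "zero_count w 0 0 0 = q + 5"
    by (simp add: zero_count_def q_def)
  moreover have "zero_count w 0 0 c = 3" if "c \<noteq> 0" for c
    using that by (auto simp: zero_count_def)
  ultimately have c: "(\<Sum>c\<in>UNIV. F (zero_count w 0 0 c)) = F (q + 5) + (int q - 1) * F 3"
    by (subst split) simp_all
  \<comment> \<open>The 2 consists of the root of x + c and the coordinate a = 0; the last two
    coordinates are w - c and c.\<close>
  have "zero_count w 0 1 c = 2 + of_bool (c = 0) * 1 + of_bool (c = w) * 1" for c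
  proof -
    have "{x. x + c = 0} = {- c}"
      by (auto simp: eq_neg_iff_add_eq_0)
    then show ?thesis by (auto simp: zero_count_def)
  qed
  then have "(\<Sum>c\<in>UNIV. F (zero_count w 0 1 c)) = (\<Sum>c\<in>UNIV. F (2 + of_bool (c = 0) * 1 + of_bool (c = w) * 1))"
    by simp
  also have "\<dots> = int q * F 2 + F 3 - F 2 + F 3 - F 2"
    using w0 by (subst sum_add_of_bool, simp, simp, subst sum_add_of_bool) (simp_all add: q_def)
  finally have d: "(\<Sum>c\<in>UNIV. F (zero_count w 0 1 c)) = int q * F 2 + F 3 - F 2 + F 3 - F 2" .
  have "2 * (\<Sum>a\<in>UNIV. \<Sum>b\<in>UNIV. \<Sum>c\<in>UNIV. F (zero_count w a b c))
    = 2 * F (q + 5) + (int q - 1) * (2 * F 3 + 2 * (\<Sum>c\<in>UNIV. F (zero_count w 0 1 c))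
        + 2 * (\<Sum>b\<in>UNIV. \<Sum>c\<in>UNIV. F (zero_count w 1 b c)))"
    unfolding a b c by (simp add: algebra_simps)
  then show ?thesis
    unfolding d sum_zero_count_monic[OF two w w1, of F, folded q_def n_def]
    by (simp add: algebra_simps)
qed

section \<open>Linear codes over finite fields\<close>

text \<open>Coordinates with respect to a basis B identify the vectors with the functions from B to
  the field. This allows dimensions to be found by counting.\<close>

lemma (in vectorspace) card_carrier:
  assumes "finite (carrier V)" and "finite (carrier K)"
  shows "card (carrier V) = card (carrier K) ^ dim"
proof -
  \<comment> \<open>A finite carrier is its own finite spanning set.\<close>
  have "span (carrier V) = carrier V"
    using in_own_span[of "carrier V"] span_is_subset2[of "carrier V"] by auto
  then have "fin_dim"
    using assms(1) by (auto simp: fin_dim_def)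
  then obtain B where B: "finite B" "basis B"
    using finite_basis_exists by blast
  then have BV: "B \<subseteq> carrier V" by (simp add: basis_def)
  have unique: "\<exists>!a. a \<in> B \<rightarrow>\<^sub>E carrier K \<and> lincomb a B = v" if "v \<in> carrier V" for v
    using basis_criterion[OF B(1) BV] B(2) that by blast
  have "bij_betw (\<lambda>a. lincomb a B) (B \<rightarrow>\<^sub>E carrier K) (carrier V)"
  proof (rule bij_betwI')
    fix a a' assume "a \<in> B \<rightarrow>\<^sub>E carrier K" "a' \<in> B \<rightarrow>\<^sub>E carrier K"
    moreover from this have "lincomb a B \<in> carrier V"
      using BV by (intro lincomb_closed) auto
    ultimately show "lincomb a B = lincomb a' B \<longleftrightarrow> a = a'"
      using unique by metis
  next
    fix a assume "a \<in> B \<rightarrow>\<^sub>E carrier K"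
    then show "lincomb a B \<in> carrier V"
      using BV by (intro lincomb_closed) auto
  next
    fix v assume "v \<in> carrier V"
    then show "\<exists>a\<in>B \<rightarrow>\<^sub>E carrier K. v = lincomb a B"
      using unique by metis
  qed
  then have "card (carrier V) = card (B \<rightarrow>\<^sub>E carrier K)"
    by (rule bij_betw_same_card[symmetric])
  also have "\<dots> = card (carrier K) ^ dim"
    using B by (simp add: card_PiE dim_basis)
  finally show ?thesis .
qed

lemma finite_carrier_vec: "finite (carrier_vec n :: 'a :: finite vec set)"
proof -
  have "(carrier_vec n :: 'a vec set) \<subseteq> vec_of_list ` {xs. set xs \<subseteq> UNIV \<and> length xs = n}"
  proof
    fix v :: "'a vec" assume "v \<in> carrier_vec n"
    then show "v \<in> vec_of_list ` {xs. set xs \<subseteq> UNIV \<and> length xs = n}"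
      by (intro image_eqI[of _ _ "list_of_vec v"]) (auto simp: vec_list)
  qed
  then show ?thesis
    by (rule finite_subset) (intro finite_imageI finite_lists_length_eq finite)
qed

lemma card_carrier_vec:
  "card (carrier_vec n :: 'a :: {field, finite} vec set) = card (UNIV :: 'a set) ^ n"
proof -
  interpret vec_space "TYPE('a)" n .
  show ?thesis
    using card_carrier finite_carrier_vec[of n] by (simp add: dim_is_n module_vec_simps)
qed

text \<open>A field has at least two elements, so the power determines the exponent. The dimensions
  of the code and of its dual are both obtained in this way.\<close>

lemma dim_eq_if_card:
  fixes W :: "'a :: {field, finite} vec set"
  assumes W: "VectorSpace.subspace class_ring W (module_vec TYPE('a) n)"
    and card: "card W = card (UNIV :: 'a set) ^ k"
  shows "vectorspace.dim class_ring ((module_vec TYPE('a) n)\<lparr>carrier := W\<rparr>) = k"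
proof -
  interpret V: vec_space "TYPE('a)" n .
  interpret W: vectorspace class_ring "(module_vec TYPE('a) n)\<lparr>carrier := W\<rparr>"
    using V.subspace_is_vs[OF W] .
  have "W \<subseteq> carrier_vec n"
    using W by (auto simp: VectorSpace.subspace_def submodule_def module_vec_simps)
  then have "finite W"
    by (rule finite_subset) (rule finite_carrier_vec)
  then have "card (UNIV :: 'a set) ^ W.dim = card (UNIV :: 'a set) ^ k"
    using W.card_carrier card by simp
  moreover have "card (UNIV :: 'a set) > 1"
    using card_mono[of UNIV "{0, 1 :: 'a}"] by simp
  ultimately show ?thesis by simp
qed

lemma subspace_dual_code:
  fixes C :: "'a :: field vec set"
  assumes "C \<subseteq> carrier_vec n"
  shows "VectorSpace.subspace class_ring (dual_code n C) (module_vec TYPE('a) n)"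
proof -
  interpret V: vec_space "TYPE('a)" n .
  have "submodule class_ring (dual_code n C) (module_vec TYPE('a) n)"
    using assms
    by unfold_locales
      (auto simp: dual_code_def module_vec_simps subset_iff add_scalar_prod_distrib[of _ n])
  then show ?thesis
    by (simp add: VectorSpace.subspace_def V.vectorspace_axioms)
qed

section \<open>The codewords as row combinations with coefficients a, b, c\<close>

definition codeword :: "nat \<Rightarrow> (nat \<Rightarrow> 'a) \<Rightarrow> 'a :: field \<Rightarrow> 'a \<Rightarrow> 'a \<Rightarrow> 'a \<Rightarrow> 'a vec" where
  "codeword q \<alpha> w a b c = vec (q + 5) (\<lambda>j. if j < q then a * (\<alpha> (Suc j))\<^sup>2 + b * \<alpha> (Suc j) + c
     else [a, b, a + b, b * w - c, a * w + c] ! (j - q))"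

lemma codeword_carrier [simp]: "codeword q \<alpha> w a b c \<in> carrier_vec (q + 5)"
  by (simp add: codeword_def)

lemma codeword_index:
  "j < q \<Longrightarrow> codeword q \<alpha> w a b c $ j = a * (\<alpha> (Suc j))\<^sup>2 + b * \<alpha> (Suc j) + c"
  "codeword q \<alpha> w a b c $ q = a"
  "codeword q \<alpha> w a b c $ (Suc q) = b"
  "codeword q \<alpha> w a b c $ (Suc (Suc q)) = a + b"
  "codeword q \<alpha> w a b c $ (Suc (Suc (Suc q))) = b * w - c"
  "codeword q \<alpha> w a b c $ (Suc (Suc (Suc (Suc q)))) = a * w + c"
  by (simp_all add: codeword_def)

text \<open>Two coordinates are a and b themselves, and the last one, aw + c, then gives c.
  Codewords can therefore be counted by triples.\<close>

lemma codeword_eq_iff: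
  assumes "q > 0" "\<alpha> q = 0"
  shows "codeword q \<alpha> w a b c = codeword q \<alpha> w a' b' c' \<longleftrightarrow> a = a' \<and> b = b' \<and> c = c'"
proof
  assume eq: "codeword q \<alpha> w a b c = codeword q \<alpha> w a' b' c'"
  have "a = a'" "b = b'"
    using codeword_index(2,3)[of q \<alpha> w] eq by metis+
  moreover have "a * w + c = a' * w + c'"
    using codeword_index(6)[of q \<alpha> w] eq by metis
  ultimately show "a = a' \<and> b = b' \<and> c = c'" by simp
qed simp

lemma gen_matrix_index:
  assumes "j < q + 5"
  shows "gen_matrix q \<alpha> w $$ (0, j) = (if j < q then (\<alpha> (Suc j))\<^sup>2 else [1, 0, 1, 0, w] ! (j - q))"
    and "gen_matrix q \<alpha> w $$ (1, j) = (if j < q then \<alpha> (Suc j) else [0, 1, 1, w, 0] ! (j - q))"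
    and "gen_matrix q \<alpha> w $$ (2, j) = (if j < q then 1 else [0, 0, 0, - 1, 1] ! (j - q))"
  using assms by (simp_all add: gen_matrix_def mat_of_rows_list_def nth_append del: upt_Suc)

text \<open>The row space is the image of the transposed matrix, which sends a vector y to the
  codeword whose coefficients are the entries of y.\<close>

lemma code_of_matrix_gen_matrix:
  "code_of_matrix (q + 5) (gen_matrix q \<alpha> w) = {codeword q \<alpha> w a b c | a b c. True}"
proof -
  interpret vec_space "TYPE('a)" "q + 5" .
  define G where "G = gen_matrix q \<alpha> w"
  have G: "G \<in> carrier_mat 3 (q + 5)"
    by (simp add: G_def gen_matrix_def mat_of_rows_list_def numeral_3_eq_3 del: upt_Suc)
  have mult: "G\<^sup>T *\<^sub>v y = codeword q \<alpha> w (y $ 0) (y $ 1) (y $ 2)" if y: "y \<in> carrier_vec 3" for y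
  proof (rule eq_vecI)
    fix j assume "j < dim_vec (codeword q \<alpha> w (y $ 0) (y $ 1) (y $ 2))"
    then have j: "j < q + 5" by (simp add: codeword_def)
    have "(G\<^sup>T *\<^sub>v y) $ j = (\<Sum>k = 0..<3. G $$ (k, j) * y $ k)"
      using G y j by (simp add: scalar_prod_def col_def)
    also have "\<dots> = G $$ (0, j) * y $ 0 + G $$ (1, j) * y $ 1 + G $$ (2, j) * y $ 2"
      by (simp add: eval_nat_numeral)
    also have "\<dots> = codeword q \<alpha> w (y $ 0) (y $ 1) (y $ 2) $ j"
    proof -
      consider "j < q" | "\<not> j < q" "j - q \<in> {0, 1, 2, 3, 4}"
        using j by fastforce
      then show ?thesis
        unfolding G_def gen_matrix_index[OF j]
        using j by cases (auto simp: codeword_def mult.commute)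
    qed
    finally show "(G\<^sup>T *\<^sub>v y) $ j = codeword q \<alpha> w (y $ 0) (y $ 1) (y $ 2) $ j" .
  qed (use G in \<open>simp add: codeword_def\<close>)
  have "\<exists>y\<in>carrier_vec 3. G\<^sup>T *\<^sub>v y = codeword q \<alpha> w a b c" for a b c
  proof
    show y: "vec 3 ((!) [a, b, c]) \<in> carrier_vec 3" by simp
    show "G\<^sup>T *\<^sub>v vec 3 ((!) [a, b, c]) = codeword q \<alpha> w a b c"
      unfolding mult[OF y] by simp
  qed
  then have "{v \<in> carrier_vec (q + 5). \<exists>y\<in>carrier_vec 3. G\<^sup>T *\<^sub>v y = v} = {codeword q \<alpha> w a b c | a b c. True}"
    using mult codeword_carrier by blast
  then have "row_space G = {codeword q \<alpha> w a b c | a b c. True}"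
    by (simp only: row_space_eq[OF G] carrier_matD[OF G])
  then show ?thesis
    by (simp add: code_of_matrix_def G_def)
qed

lemma hamming_weight_codeword:
  fixes \<alpha> :: "nat \<Rightarrow> 'a :: {field, finite}"
  assumes \<alpha>: "bij_betw \<alpha> {1..q} UNIV"
  shows "hamming_weight (codeword q \<alpha> w a b c) + zero_count w a b c = q + 5"
proof -
  define v where "v = codeword q \<alpha> w a b c"
  have dim: "dim_vec v = q + 5" by (simp add: v_def codeword_def)
  have "hamming_weight v + card {j. j < q + 5 \<and> v $ j = 0}
      = card ({i. i < q + 5 \<and> v $ i \<noteq> 0} \<union> {j. j < q + 5 \<and> v $ j = 0})"
    unfolding hamming_weight_def dim by (rule card_Un_disjoint[symmetric]) auto
  also have "{i. i < q + 5 \<and> v $ i \<noteq> 0} \<union> {j. j < q + 5 \<and> v $ j = 0} = {..<q + 5}"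
    by auto
  finally have "hamming_weight v + card {j. j < q + 5 \<and> v $ j = 0} = q + 5"
    by simp
  moreover have "card {j. j < q + 5 \<and> v $ j = 0} = zero_count w a b c"
  proof -
    have "card {j. j < q + 5 \<and> v $ j = 0} = (\<Sum>j<q + 5. of_bool (v $ j = 0))"
      by (simp add: sum.If_cases of_bool_def Int_def)
    also have "\<dots> = (\<Sum>j<q. of_bool (v $ j = 0)) + of_bool (v $ q = 0) + of_bool (v $ Suc q = 0)
        + of_bool (v $ Suc (Suc q) = 0) + of_bool (v $ Suc (Suc (Suc q)) = 0)
        + of_bool (v $ Suc (Suc (Suc (Suc q))) = 0)"
      by (simp add: eval_nat_numeral)
    also have "(\<Sum>j<q. of_bool (v $ j = 0)) = (\<Sum>j<q. of_bool (a * (\<alpha> (Suc j))\<^sup>2 + b * \<alpha> (Suc j) + c = 0))"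
      by (simp add: v_def codeword_index)
    \<comment> \<open>Columns are counted from 0 and the enumeration from 1; after this shift the
      bijection turns the sum into one over the field.\<close>
    also have "\<dots> = (\<Sum>j\<in>{1..q}. of_bool (a * (\<alpha> j)\<^sup>2 + b * \<alpha> j + c = 0))"
      by (simp add: sum.atLeast1_atMost_eq)
    also have "\<dots> = (\<Sum>x\<in>UNIV. of_bool (a * x\<^sup>2 + b * x + c = 0))"
      by (rule sum.reindex_bij_betw[OF \<alpha>])
    also have "\<dots> = card {x. a * x\<^sup>2 + b * x + c = 0}"
      by (simp add: sum.If_cases of_bool_def)
    finally show ?thesis
      by (simp add: v_def codeword_index zero_count_def)
  qed
  ultimately show ?thesis by (simp add: v_def)
qed

section \<open>Weights of the code and its dual\<close>

lemma finite_code: "finite {codeword q \<alpha> w a b c | a b c. True}" for w :: "'a :: {field, finite}"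
  by (rule finite_subset[OF _ finite_carrier_vec[of "q + 5"]]) auto

lemma card_code:
  fixes w :: "'a :: {field, finite}"
  assumes "q > 0" "\<alpha> q = 0"
  shows "card {codeword q \<alpha> w a b c | a b c. P (codeword q \<alpha> w a b c)}
    = card {(a, b, c). P (codeword q \<alpha> w a b c)}"
proof -
  have "inj_on (\<lambda>(a, b, c). codeword q \<alpha> w a b c) {(a, b, c). P (codeword q \<alpha> w a b c)}"
    using assms by (auto simp: inj_on_def codeword_eq_iff)
  moreover have "(\<lambda>(a, b, c). codeword q \<alpha> w a b c) ` {(a, b, c). P (codeword q \<alpha> w a b c)}
      = {codeword q \<alpha> w a b c | a b c. P (codeword q \<alpha> w a b c)}"
    by force
  ultimately show ?thesis
    using card_image by force
qed

text \<open>This is \<open>sum_zero_count\<close> for the indicator of q + 5 - j zeros, written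
  additively to avoid truncated subtraction. The summand for j = 0 is the zero word.\<close>

lemma weight_count_code:
  fixes w :: "'a :: {field, finite}"
  defines "q \<equiv> card (UNIV :: 'a set)" and "n \<equiv> int (num_sqrts (- w))"
  assumes two: "(2 :: 'a) \<noteq> 0" and w: "num_sqrts w = 0" and w1: "num_sqrts (1 + 4 * w) = 0"
    and \<alpha>: "bij_betw \<alpha> {1..q} UNIV" "\<alpha> q = 0"
  shows "2 * int (weight_count {codeword q \<alpha> w a b c | a b c. True} j)
    = 2 * of_bool (j = 0) + (int q - 1) * ((int q ^ 2 - 5 * int q + 8 + n) * of_bool (j = q + 5)
        + (6 * int q - 18 - 3 * n) * of_bool (j = q + 4)
        + (int q ^ 2 - 3 * int q + 8 + 3 * n) * of_bool (j = q + 3)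
        + (4 * int q + 4 - n) * of_bool (j = q + 2))"
proof -
  have "q > 0" by (simp add: q_def card_gt_0_iff)
  have "{x \<in> {codeword q \<alpha> w a b c | a b c. True}. hamming_weight x = j}
      = {codeword q \<alpha> w a b c | a b c. hamming_weight (codeword q \<alpha> w a b c) = j}"
    by auto
  then have "weight_count {codeword q \<alpha> w a b c | a b c. True} j
      = card {(a, b, c). hamming_weight (codeword q \<alpha> w a b c) = j}"
    unfolding weight_count_def using card_code[where \<alpha> = \<alpha>, OF \<open>q > 0\<close> \<alpha>(2)] by simp
  also have "{(a, b, c). hamming_weight (codeword q \<alpha> w a b c) = j} = {(a, b, c). j + zero_count w a b c = q + 5}"
  proof -
    have "hamming_weight (codeword q \<alpha> w a b c) = j \<longleftrightarrow> j + zero_count w a b c = q + 5" for a b c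
      using hamming_weight_codeword[OF \<alpha>(1), of w a b c] by linarith
    then show ?thesis by simp
  qed
  also have "int (card {(a, b, c). j + zero_count w a b c = q + 5})
      = (\<Sum>(a, b, c)\<in>UNIV. of_bool (j + zero_count w a b c = q + 5))"
    by (simp add: case_prod_unfold of_bool_def sum.If_cases)
  also have "\<dots> = (\<Sum>a\<in>UNIV. \<Sum>b\<in>UNIV. \<Sum>c\<in>UNIV. of_bool (j + zero_count w a b c = q + 5))"
    by (simp only: sum.cartesian_product UNIV_Times_UNIV)
  finally show ?thesis
    using sum_zero_count[OF two w w1, of "\<lambda>z. of_bool (j + z = q + 5)"]
    by (simp add: n_def flip: q_def)
qed

lemma codeword_linear:
  assumes "i < q + 5"
  shows "codeword q \<alpha> w a b c $ i
    = a * codeword q \<alpha> w 1 0 0 $ i + b * codeword q \<alpha> w 0 1 0 $ i + c * codeword q \<alpha> w 0 0 1 $ i"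
proof -
  consider "i < q" | "\<not> i < q" "i - q \<in> {0, 1, 2, 3, 4}"
    using assms by fastforce
  then show ?thesis
    using assms by cases (auto simp: codeword_def algebra_simps)
qed

lemma scalar_prod_codeword:
  "v \<bullet> codeword q \<alpha> w a b c
    = a * (v \<bullet> codeword q \<alpha> w 1 0 0) + b * (v \<bullet> codeword q \<alpha> w 0 1 0) + c * (v \<bullet> codeword q \<alpha> w 0 0 1)"
proof -
  have dim: "dim_vec (codeword q \<alpha> w a b c) = q + 5" for a b c
    by (simp add: codeword_def)
  have "v \<bullet> codeword q \<alpha> w a b c = (\<Sum>i = 0..<q + 5. a * (v $ i * codeword q \<alpha> w 1 0 0 $ i)
      + b * (v $ i * codeword q \<alpha> w 0 1 0 $ i) + c * (v $ i * codeword q \<alpha> w 0 0 1 $ i))"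
    unfolding scalar_prod_def dim
  proof (rule sum.cong[OF refl])
    fix i assume "i \<in> {0..<q + 5}"
    then show "v $ i * codeword q \<alpha> w a b c $ i = a * (v $ i * codeword q \<alpha> w 1 0 0 $ i)
      + b * (v $ i * codeword q \<alpha> w 0 1 0 $ i) + c * (v $ i * codeword q \<alpha> w 0 0 1 $ i)"
      by (subst codeword_linear) (simp_all add: algebra_simps)
  qed
  then show ?thesis
    by (simp add: scalar_prod_def dim sum.distrib sum_distrib_left)
qed

section \<open>The dual code: its size and minimum weight\<close>

lemma mem_dual_code_iff:
  "v \<in> dual_code (q + 5) {codeword q \<alpha> w a b c | a b c. True} \<longleftrightarrow> v \<in> carrier_vec (q + 5)
    \<and> v \<bullet> codeword q \<alpha> w 1 0 0 = 0 \<and> v \<bullet> codeword q \<alpha> w 0 1 0 = 0 \<and> v \<bullet> codeword q \<alpha> w 0 0 1 = 0"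
proof
  assume *: "v \<in> carrier_vec (q + 5)
    \<and> v \<bullet> codeword q \<alpha> w 1 0 0 = 0 \<and> v \<bullet> codeword q \<alpha> w 0 1 0 = 0 \<and> v \<bullet> codeword q \<alpha> w 0 0 1 = 0"
  have "v \<bullet> codeword q \<alpha> w a b c = 0" for a b c
    unfolding scalar_prod_codeword[of v q \<alpha> w a b c] using * by simp
  with * show "v \<in> dual_code (q + 5) {codeword q \<alpha> w a b c | a b c. True}"
    by (auto simp: dual_code_def)
qed (auto simp: dual_code_def)

text \<open>Every vector differs from exactly one vector of the dual code by a vector supported on the
  positions \<open>q - 1\<close>, \<open>q\<close> and \<open>q + 1\<close>, where the generator matrix has the unit vectors as columns.\<close>

lemma card_dual_code:
  fixes w :: "'a :: {field, finite}"
  assumes "q > 0" and "\<alpha> q = 0"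
  shows "card (dual_code (q + 5) {codeword q \<alpha> w a b c | a b c. True}) = card (UNIV :: 'a set) ^ (q + 2)"
proof -
  define D where "D = dual_code (q + 5) {codeword q \<alpha> w a b c | a b c. True}"
  \<comment> \<open>Position q - 1 belongs to \<open>\<alpha> q\<close> = 0 and has column (0, 0,
    1); positions q and q + 1 have (1, 0, 0) and (0, 1, 0). With \<open>s\<close> as the syndrome,
    \<open>e t\<close> is thus a vector of syndrome t.\<close>
  define e where "e = (\<lambda>(x, y, z). vec (q + 5) (\<lambda>i. if i = q then x else if i = Suc q then y
      else if i = q - 1 then z else (0 :: 'a)))"
  define s where "s v = (v \<bullet> codeword q \<alpha> w 1 0 0, v \<bullet> codeword q \<alpha> w 0 1 0, v \<bullet> codeword q \<alpha> w 0 0 1)" for v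
  have e_carrier [simp]: "e t \<in> carrier_vec (q + 5)" for t
    by (simp add: e_def split: prod.split)
  have e_dim [simp]: "dim_vec (e t) = q + 5" for t
    by (simp add: e_def split: prod.split)
  have e_prod: "e (x, y, z) \<bullet> codeword q \<alpha> w a b c = a * x + b * y + c * z" for x y z a b c
  proof -
    have "e (x, y, z) \<bullet> codeword q \<alpha> w a b c
        = (\<Sum>i\<in>{q - 1, q, Suc q}. e (x, y, z) $ i * codeword q \<alpha> w a b c $ i)"
      unfolding scalar_prod_def by (rule sum.mono_neutral_right) (use assms in \<open>auto simp: e_def codeword_def\<close>)
    moreover obtain r where "q = Suc r"
      using assms(1) gr0_implies_Suc by blast
    ultimately show ?thesis
      using assms(2) by (simp add: e_def codeword_def algebra_simps)
  qed
  have s_e: "s (e t) = t" for t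
    by (cases t) (simp add: s_def e_prod)
  have s_add: "s (u + v) = (fst (s u) + fst (s v), fst (snd (s u)) + fst (snd (s v)), snd (snd (s u)) + snd (snd (s v)))"
    if "u \<in> carrier_vec (q + 5)" "v \<in> carrier_vec (q + 5)" for u v
    using that by (simp add: s_def add_scalar_prod_distrib[of _ "q + 5"])
  have s_diff: "s (u - v) = (fst (s u) - fst (s v), fst (snd (s u)) - fst (snd (s v)), snd (snd (s u)) - snd (snd (s v)))"
    if "u \<in> carrier_vec (q + 5)" "v \<in> carrier_vec (q + 5)" for u v
    using that by (simp add: s_def minus_scalar_prod_distrib[of _ "q + 5"])
  have D: "v \<in> D \<longleftrightarrow> v \<in> carrier_vec (q + 5) \<and> s v = (0, 0, 0)" for v
    unfolding D_def mem_dual_code_iff by (simp add: s_def)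
  \<comment> \<open>The inverse reads off the syndrome and subtracts the chosen vector with that
    syndrome.\<close>
  have "bij_betw (\<lambda>(v, t). v + e t) (D \<times> UNIV) (carrier_vec (q + 5))"
  proof (rule bij_betw_byWitness[where f' = "\<lambda>v. (v - e (s v), s v)"])
    have "v + e t - e t = v" if "v \<in> D" for v t
    proof (rule eq_vecI)
      have "v \<in> carrier_vec (q + 5)" using that by (simp add: D)
      then show "(v + e t - e t) $ i = v $ i" if "i < dim_vec v" for i
        using that by simp
      show "dim_vec (v + e t - e t) = dim_vec v"
        using \<open>v \<in> carrier_vec (q + 5)\<close> by simp
    qed
    moreover have "s (v + e t) = t" if "v \<in> D" for v t
      using that unfolding D by (simp add: s_add s_e)
    ultimately show "\<forall>p\<in>D \<times> UNIV. (\<lambda>v. (v - e (s v), s v)) (case p of (v, t) \<Rightarrow> v + e t) = p"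
      by (simp add: Ball_def)
    have "v - e (s v) + e (s v) = v" if "v \<in> carrier_vec (q + 5)" for v
    proof (rule eq_vecI)
      show "(v - e (s v) + e (s v)) $ i = v $ i" if "i < dim_vec v" for i
        using that \<open>v \<in> carrier_vec (q + 5)\<close> by simp
      show "dim_vec (v - e (s v) + e (s v)) = dim_vec v"
        using \<open>v \<in> carrier_vec (q + 5)\<close> by simp
    qed
    then show "\<forall>v\<in>carrier_vec (q + 5). (case (v - e (s v), s v) of (v, t) \<Rightarrow> v + e t) = v"
      by simp
    show "(\<lambda>(v, t). v + e t) ` (D \<times> UNIV) \<subseteq> carrier_vec (q + 5)"
      using D by auto
    show "(\<lambda>v. (v - e (s v), s v)) ` carrier_vec (q + 5) \<subseteq> D \<times> UNIV"
      by (auto simp: D s_diff s_e)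
  qed
  then have "card (D \<times> (UNIV :: ('a \<times> 'a \<times> 'a) set)) = card (UNIV :: 'a set) ^ (q + 5)"
    using card_carrier_vec[where 'a = 'a] by (metis bij_betw_same_card)
  moreover have "card (UNIV :: ('a \<times> 'a \<times> 'a) set) = card (UNIV :: 'a set) ^ 3"
    by (simp add: power3_eq_cube card_cartesian_product flip: UNIV_Times_UNIV)
  ultimately have "card D * card (UNIV :: 'a set) ^ 3 = card (UNIV :: 'a set) ^ (q + 5)"
    by (simp add: card_cartesian_product)
  moreover have "q + 5 = (q + 2) + 3" by simp
  ultimately have "card D * card (UNIV :: 'a set) ^ 3 = card (UNIV :: 'a set) ^ (q + 2) * card (UNIV :: 'a set) ^ 3"
    by (simp only: power_add)
  moreover have "card (UNIV :: 'a set) > 0"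
    by (simp add: card_gt_0_iff)
  ultimately show ?thesis by (simp add: D_def)
qed

text \<open>The words whose coefficient triple is a unit vector are the rows of the matrix, so
  \<open>eq\<close> at these triples compares columns i and j row by row.\<close>

lemma columns_independent:
  fixes w :: "'a :: field"
  assumes w: "w \<noteq> 0" and inj: "inj_on \<alpha> {1..q}" and ij: "i < j" "j < q + 5"
    and eq: "\<And>a b c. s * codeword q \<alpha> w a b c $ i + t * codeword q \<alpha> w a b c $ j = 0"
  shows "s = 0 \<and> t = 0"
proof -
  have "j = q \<or> j = Suc q \<or> j = Suc (Suc q) \<or> j = Suc (Suc (Suc q)) \<or> j = Suc (Suc (Suc (Suc q)))"
    if "\<not> j < q"
    using that ij by linarith
  moreover have "i = q \<or> i = Suc q \<or> i = Suc (Suc q) \<or> i = Suc (Suc (Suc q))" if "\<not> i < q"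
    using that ij by linarith
  ultimately consider "i < q" "j < q"
    | "i < q" "j = q \<or> j = Suc q \<or> j = Suc (Suc q) \<or> j = Suc (Suc (Suc q)) \<or> j = Suc (Suc (Suc (Suc q)))"
    | "i = q \<or> i = Suc q \<or> i = Suc (Suc q) \<or> i = Suc (Suc (Suc q))"
      "j = q \<or> j = Suc q \<or> j = Suc (Suc q) \<or> j = Suc (Suc (Suc q)) \<or> j = Suc (Suc (Suc (Suc q)))"
    using ij by linarith
  then show ?thesis
  proof cases
    case 1
    have "t = - s"
      using eq[of 0 0 1] 1 by (simp add: codeword_index eq_neg_iff_add_eq_0 add.commute)
    moreover have "\<alpha> (Suc i) \<noteq> \<alpha> (Suc j)"
      using inj ij 1 by (auto dest: inj_onD)
    ultimately show ?thesis
      using eq[of 0 1 0] 1 by (simp add: codeword_index)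
  next
    case 2
    define x where "x = \<alpha> (Suc i)"
    \<comment> \<open>An evaluation column (x^2, x, 1) meets an extra column. If the latter ends in
      0, the last row gives s = 0. Otherwise s = t or s = -t, another row gives s = 0 or x = 0, and
      the row containing w finishes.\<close>
    from 2(2) show ?thesis
    proof (elim disjE)
      assume j: "j = Suc (Suc (Suc q))"
      have "s = t" "s = 0 \<or> x = 0" "s * x + t * w = 0"
        using eq[of 0 0 1] eq[of 1 0 0] eq[of 0 1 0] 2(1) by (simp_all add: j codeword_index x_def)
      then show ?thesis using w by auto
    next
      assume j: "j = Suc (Suc (Suc (Suc q)))"
      have "s = - t" "s = 0 \<or> x = 0" "s * x\<^sup>2 + t * w = 0"
        using eq[of 0 0 1] eq[of 1 0 0] eq[of 0 1 0] 2(1)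
        by (simp_all add: j codeword_index x_def eq_neg_iff_add_eq_0)
      then show ?thesis using w by auto
    qed (use eq[of 0 0 1] eq[of 1 0 0] eq[of 0 1 0] 2(1) in \<open>simp_all add: codeword_index\<close>)
  next
    case 3
    from 3 ij(1) eq[of 1 0 0] eq[of 0 1 0] eq[of 0 0 1] w show ?thesis
      by (elim disjE) (simp_all add: codeword_index)
  qed
qed

text \<open>A nonzero dual word of weight at most 2 would be a linear dependency between two columns
  of the generator matrix.\<close>

lemma hamming_weight_dual_ge_3:
  fixes w :: "'a :: field"
  assumes w: "w \<noteq> 0" and inj: "inj_on \<alpha> {1..q}"
    and v: "v \<in> dual_code (q + 5) {codeword q \<alpha> w a b c | a b c. True}" and nz: "v \<noteq> 0\<^sub>v (q + 5)"
  shows "3 \<le> hamming_weight v"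
proof (rule ccontr)
  assume "\<not> 3 \<le> hamming_weight v"
  moreover have dim: "dim_vec v = q + 5"
    using v by (auto simp: dual_code_def)
  ultimately have "card {i. i < q + 5 \<and> v $ i \<noteq> 0} \<le> 2"
    by (simp add: hamming_weight_def)
  \<comment> \<open>Enlarging the support to exactly two positions treats all weights below 3
    alike.\<close>
  then have "\<exists>T. {i. i < q + 5 \<and> v $ i \<noteq> 0} \<subseteq> T \<and> T \<subseteq> {..<q + 5} \<and> card T = 2"
    by (rule exists_subset_between) auto
  then obtain T where T: "{i. i < q + 5 \<and> v $ i \<noteq> 0} \<subseteq> T" "T \<subseteq> {..<q + 5}" "card T = 2"
    by blast
  obtain i j where ij: "i < j" "T = {i, j}"
  proof -
    from T(3) obtain k l where kl: "T = {k, l}" "k \<noteq> l"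
      unfolding card_2_iff by blast
    show thesis
    proof (cases "k < l")
      case False
      then show thesis using kl by (intro that[of l k]) auto
    qed (use kl that in simp)
  qed
  have zero: "v $ k = 0" if "k < q + 5" "k \<notin> T" for k
    using that T(1) by auto
  have "v $ i * codeword q \<alpha> w a b c $ i + v $ j * codeword q \<alpha> w a b c $ j = 0" for a b c
  proof -
    have "v \<bullet> codeword q \<alpha> w a b c = (\<Sum>k\<in>T. v $ k * codeword q \<alpha> w a b c $ k)"
      unfolding scalar_prod_def
      by (rule sum.mono_neutral_right) (use T zero in \<open>auto simp: codeword_def\<close>)
    moreover have "v \<bullet> codeword q \<alpha> w a b c = 0"
      using v by (auto simp: dual_code_def)
    ultimately show ?thesis
      using ij by simp
  qed
  then have "v $ i = 0 \<and> v $ j = 0"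
    using T(2) ij by (intro columns_independent[OF w inj ij(1)]) auto
  then have "v $ k = 0" if "k < q + 5" for k
    using that zero ij(2) by (cases "k \<in> T") auto
  then have "v = 0\<^sub>v (q + 5)"
    using dim by auto
  with nz show False ..
qed

text \<open>The word comes from the dependency (1, 0, 0) + (0, 1, 0) - (1, 1, 0) = 0 of three extra
  columns.\<close>

lemma ex_dual_hamming_weight_3:
  "\<exists>v\<in>dual_code (q + 5) {codeword q \<alpha> w a b c | a b c. True}. v \<noteq> 0\<^sub>v (q + 5) \<and> hamming_weight v = 3"
  for w :: "'a :: field"
proof
  define v :: "'a vec" where "v = vec (q + 5) (\<lambda>i. if i = q \<or> i = Suc q then 1 else if i = Suc (Suc q) then - 1 else 0)"
  have "v \<bullet> codeword q \<alpha> w a b c = 0" for a b c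
  proof -
    have "v \<bullet> codeword q \<alpha> w a b c = (\<Sum>i\<in>{q, Suc q, Suc (Suc q)}. v $ i * codeword q \<alpha> w a b c $ i)"
      unfolding scalar_prod_def by (rule sum.mono_neutral_right) (auto simp: v_def codeword_def)
    then show ?thesis
      by (simp add: v_def codeword_index)
  qed
  then show "v \<in> dual_code (q + 5) {codeword q \<alpha> w a b c | a b c. True}"
    by (auto simp: dual_code_def v_def)
  have "{i. i < dim_vec v \<and> v $ i \<noteq> 0} = {q, Suc q, Suc (Suc q)}"
    by (auto simp: v_def split: if_splits)
  then have "hamming_weight v = 3"
    by (simp add: hamming_weight_def)
  moreover have "hamming_weight (0\<^sub>v (q + 5) :: 'a vec) = 0"
    by (simp add: hamming_weight_def)
  ultimately show "v \<noteq> 0\<^sub>v (q + 5) \<and> hamming_weight v = 3"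
    by auto
qed

section \<open>Code parameters and the weight enumerator\<close>

lemma subspace_code_of_matrix:
  fixes G :: "'a :: field mat"
  assumes "G \<in> carrier_mat k n"
  shows "VectorSpace.subspace class_ring (code_of_matrix n G) (module_vec TYPE('a) n)"
proof -
  interpret vec_space "TYPE('a)" n .
  show ?thesis
    unfolding code_of_matrix_def row_space_def
    by (rule span_is_subspace) (use assms rows_carrier[of G] in \<open>auto simp: module_vec_simps\<close>)
qed

text \<open>The minimum weight is read off from the weight distribution: the count at q + 2 is
  positive, and the counts at smaller nonzero weights vanish.\<close>

lemma linear_code_code:
  fixes w :: "'a :: {field, finite}"
  defines "q \<equiv> card (UNIV :: 'a set)"
  assumes two: "(2 :: 'a) \<noteq> 0" and w: "num_sqrts w = 0" and w1: "num_sqrts (1 + 4 * w) = 0"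
    and \<alpha>: "bij_betw \<alpha> {1..q} UNIV" "\<alpha> q = 0"
    and C: "C = code_of_matrix (q + 5) (gen_matrix q \<alpha> w)"
  shows "linear_code (q + 5) 3 (q + 2) C"
    and "linear_code (q + 5) (q + 2) 3 (dual_code (q + 5) C)"
proof -
  have C_eq: "C = {codeword q \<alpha> w a b c | a b c. True}"
    unfolding C by (rule code_of_matrix_gen_matrix)
  have q: "q > 1"
    unfolding q_def using card_mono[of UNIV "{0, 1 :: 'a}"] by simp
  then have q0: "q > 0" by simp
  have finite: "finite C"
    unfolding C_eq by (rule finite_code)
  have carrier: "C \<subseteq> carrier_vec (q + 5)"
    unfolding C_eq by auto
  have w0: "w \<noteq> 0" using w by auto
  have n: "num_sqrts (- w) \<le> 2"
    by (cases "- w" rule: num_sqrts_cases[OF two]) simp_all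
  have count: "2 * int (weight_count C j)
    = 2 * of_bool (j = 0) + (int q - 1) * ((int q ^ 2 - 5 * int q + 8 + int (num_sqrts (- w))) * of_bool (j = q + 5)
        + (6 * int q - 18 - 3 * int (num_sqrts (- w))) * of_bool (j = q + 4)
        + (int q ^ 2 - 3 * int q + 8 + 3 * int (num_sqrts (- w))) * of_bool (j = q + 3)
        + (4 * int q + 4 - int (num_sqrts (- w))) * of_bool (j = q + 2))" for j
    unfolding C_eq q_def by (rule weight_count_code[OF two w w1 \<alpha>[unfolded q_def]])
  have subspace: "VectorSpace.subspace class_ring C (module_vec TYPE('a) (q + 5))"
    unfolding C by (rule subspace_code_of_matrix[where k = 3])
      (simp add: gen_matrix_def mat_of_rows_list_def numeral_3_eq_3 del: upt_Suc)
  have "{(a, b, c). True} = (UNIV :: ('a \<times> 'a \<times> 'a) set)"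
    by auto
  then have "card C = card (UNIV :: ('a \<times> 'a \<times> 'a) set)"
    unfolding C_eq using card_code[where P = "\<lambda>_. True" and \<alpha> = \<alpha> and w = w, OF q0 \<alpha>(2)] by simp
  then have "card C = card (UNIV :: 'a set) ^ 3"
    by (simp add: power3_eq_cube card_cartesian_product flip: UNIV_Times_UNIV)
  then have dim: "vectorspace.dim class_ring ((module_vec TYPE('a) (q + 5))\<lparr>carrier := C\<rparr>) = 3"
    by (rule dim_eq_if_card[OF subspace])
  have "2 * int (weight_count C (q + 2)) = (int q - 1) * (4 * int q + 4 - int (num_sqrts (- w)))"
    unfolding count[of "q + 2"] by simp
  \<comment> \<open>Positive since q > 1 and -w has at most two square roots.\<close>
  moreover have "(int q - 1) * (4 * int q + 4 - int (num_sqrts (- w))) > 0"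
    using q n by (intro mult_pos_pos) linarith+
  ultimately have "weight_count C (q + 2) > 0"
    by linarith
  then have "{c \<in> C. hamming_weight c = q + 2} \<noteq> {}"
    unfolding weight_count_def by (metis card.empty less_irrefl)
  then obtain c where c: "c \<in> C" "hamming_weight c = q + 2" by blast
  moreover have "hamming_weight (0\<^sub>v (q + 5) :: 'a vec) = 0"
    by (simp add: hamming_weight_def)
  ultimately have ex: "\<exists>c\<in>C. c \<noteq> 0\<^sub>v (q + 5) \<and> hamming_weight c = q + 2"
    by (metis add_is_0 zero_neq_numeral)
  have min: "q + 2 \<le> hamming_weight c" if "c \<in> C" "c \<noteq> 0\<^sub>v (q + 5)" for c
  proof (rule ccontr)
    assume less: "\<not> q + 2 \<le> hamming_weight c"
    have "c \<in> carrier_vec (q + 5)" using that carrier by auto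
    then have "\<exists>i. i < dim_vec c \<and> c $ i \<noteq> 0"
      using that(2) by (metis carrier_vecD eq_vecI index_zero_vec)
    then have "hamming_weight c \<noteq> 0"
      by (auto simp: hamming_weight_def)
    \<comment> \<open>For a nonzero weight below q + 2 all the indicators in \<open>count\<close>
      are 0.\<close>
    then have "2 * int (weight_count C (hamming_weight c)) = 0"
      unfolding count using less by simp
    then have "{x \<in> C. hamming_weight x = hamming_weight c} = {}"
      using finite by (simp add: weight_count_def)
    with that(1) show False by blast
  qed
  show "linear_code (q + 5) 3 (q + 2) C"
    using subspace dim ex min by (simp add: linear_code_def)
  have inj: "inj_on \<alpha> {1..q}"
    using \<alpha>(1) by (rule bij_betw_imp_inj_on)
  have "vectorspace.dim class_ring ((module_vec TYPE('a) (q + 5))\<lparr>carrier := dual_code (q + 5) C\<rparr>) = q + 2"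
    unfolding C_eq
    by (rule dim_eq_if_card[OF subspace_dual_code[OF carrier, unfolded C_eq]])
      (rule card_dual_code[where \<alpha> = \<alpha>, OF q0 \<alpha>(2)])
  then show "linear_code (q + 5) (q + 2) 3 (dual_code (q + 5) C)"
    using subspace_dual_code[OF carrier] ex_dual_hamming_weight_3[of q \<alpha> w]
      hamming_weight_dual_ge_3[OF w0 inj]
    by (simp add: linear_code_def C_eq)
qed

text \<open>Both residues of q mod 4 are covered by one formula in n, the number of square roots of
  -w. The doubled integer counts are moved to the rationals, where they can be halved.\<close>

lemma weight_enumerator_code:
  fixes w :: "'a :: {field, finite}"
  defines "q \<equiv> card (UNIV :: 'a set)"
  defines "k \<equiv> of_nat q :: rat" and "n \<equiv> of_nat (num_sqrts (- w)) :: rat"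
  assumes two: "(2 :: 'a) \<noteq> 0" and w: "num_sqrts w = 0" and w1: "num_sqrts (1 + 4 * w) = 0"
    and \<alpha>: "bij_betw \<alpha> {1..q} UNIV" "\<alpha> q = 0"
    and C: "C = code_of_matrix (q + 5) (gen_matrix q \<alpha> w)"
  shows "weight_enumerator (q + 5) C = 1
    + monom ((k - 1) * (4 * k + 4 - n) / 2) (q + 2)
    + monom ((k - 1) * (k\<^sup>2 - 3 * k + 8 + 3 * n) / 2) (q + 3)
    + monom ((k - 1) * (6 * k - 18 - 3 * n) / 2) (q + 4)
    + monom ((k - 1) * (k\<^sup>2 - 5 * k + 8 + n) / 2) (q + 5)"
proof -
  have C_eq: "C = {codeword q \<alpha> w a b c | a b c. True}"
    unfolding C by (rule code_of_matrix_gen_matrix)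
  have "2 * int (weight_count C j)
    = 2 * of_bool (j = 0) + (int q - 1) * ((int q ^ 2 - 5 * int q + 8 + int (num_sqrts (- w))) * of_bool (j = q + 5)
        + (6 * int q - 18 - 3 * int (num_sqrts (- w))) * of_bool (j = q + 4)
        + (int q ^ 2 - 3 * int q + 8 + 3 * int (num_sqrts (- w))) * of_bool (j = q + 3)
        + (4 * int q + 4 - int (num_sqrts (- w))) * of_bool (j = q + 2))" for j
    unfolding C_eq q_def by (rule weight_count_code[OF two w w1 \<alpha>[unfolded q_def]])
  from this[THEN arg_cong[where f = rat_of_int]]
  have count: "2 * of_nat (weight_count C j)
    = 2 * of_bool (j = 0) + (k - 1) * ((k\<^sup>2 - 5 * k + 8 + n) * of_bool (j = q + 5)
        + (6 * k - 18 - 3 * n) * of_bool (j = q + 4)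
        + (k\<^sup>2 - 3 * k + 8 + 3 * n) * of_bool (j = q + 3)
        + (4 * k + 4 - n) * of_bool (j = q + 2))" for j
    by (simp add: k_def n_def)
  have "(\<Sum>i = 1..Suc q. monom (of_nat (weight_count C i)) i) = (0 :: rat poly)"
  proof (rule sum.neutral, rule ballI)
    fix i assume "i \<in> {1..Suc q}"
    then have "2 * rat_of_nat (weight_count C i) = 0"
      unfolding count by simp
    then show "monom (rat_of_nat (weight_count C i)) i = 0" by simp
  qed
  moreover have "rat_of_nat (weight_count C (q + 2)) = (k - 1) * (4 * k + 4 - n) / 2"
    "rat_of_nat (weight_count C (q + 3)) = (k - 1) * (k\<^sup>2 - 3 * k + 8 + 3 * n) / 2"
    "rat_of_nat (weight_count C (q + 4)) = (k - 1) * (6 * k - 18 - 3 * n) / 2"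
    "rat_of_nat (weight_count C (q + 5)) = (k - 1) * (k\<^sup>2 - 5 * k + 8 + n) / 2"
    using count[of "q + 2"] count[of "q + 3"] count[of "q + 4"] count[of "q + 5"]
    by (simp_all only: eq_divide_eq_numeral1 mult.commute[of _ "2 :: rat"]) simp_all
  moreover have "(\<Sum>i = 1..q + 5. f i) = (\<Sum>i = 1..Suc q. f i) + f (q + 2) + f (q + 3) + f (q + 4) + f (q + 5)"
    for f :: "nat \<Rightarrow> rat poly"
    by (simp add: eval_nat_numeral)
  ultimately show ?thesis
    by (simp only: weight_enumerator_def add_0 add.assoc)
qed

theorem theorem3p7:
  fixes w :: "'a :: {field, finite}" and \<alpha> :: "nat \<Rightarrow> 'a" and p m q :: nat
    and C :: "'a vec set"
  assumes "prime p" and "odd p" and "m > 0"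
    and "q = p ^ m" and "card (UNIV :: 'a set) = q"
    and "quad_char w = - 1" and "quad_char (1 + 4 * w) = - 1"
    and "bij_betw \<alpha> {1..q} UNIV" and "\<alpha> q = 0"
    and "C = code_of_matrix (q + 5) (gen_matrix q \<alpha> w)"
  shows "linear_code (q + 5) 3 (q + 2) C \<and>
    nmds (q + 5) C \<and>
    (q mod 4 = 1 \<longrightarrow> weight_enumerator (q + 5) C =
           1 + monom ((2 * of_nat q + 2) * (of_nat q - 1)) (q + 2)
             + monom ((of_nat q - 1) * ((of_nat q)\<^sup>2 - 3 * of_nat q + 8) / 2) (q + 3)
             + monom ((3 * of_nat q - 9) * (of_nat q - 1)) (q + 4)
             + monom ((of_nat q - 1) * ((of_nat q)\<^sup>2 - 5 * of_nat q + 8) / 2) (q + 5)) \<and>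
    (q mod 4 = 3 \<longrightarrow> weight_enumerator (q + 5) C =
           1 + monom ((2 * of_nat q + 1) * (of_nat q - 1)) (q + 2)
             + monom ((of_nat q - 1) * ((of_nat q)\<^sup>2 - 3 * of_nat q + 14) / 2) (q + 3)
             + monom ((3 * of_nat q - 12) * (of_nat q - 1)) (q + 4)
             + monom ((of_nat q - 1) * ((of_nat q)\<^sup>2 - 5 * of_nat q + 10) / 2) (q + 5))"
proof -
  have q: "q = card (UNIV :: 'a set)" using assms(5) by simp
  have "odd q" using assms(2,4) by simp
  then have two: "(2 :: 'a) \<noteq> 0"
    unfolding q by (rule two_neq_zero_of_odd_card)
  note w = num_sqrts_eq_0_if_quad_char[OF assms(6)]
  note w1 = num_sqrts_eq_0_if_quad_char[OF assms(7)]
  note code = linear_code_code[OF two w w1 assms(8-10)[unfolded q], folded q]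
  note enum = weight_enumerator_code[OF two w w1 assms(8-10)[unfolded q], folded q]
  have "nmds (q + 5) C"
    \<comment> \<open>The parameters are k = d' = 3 and d = k' = q + 2, so both defects equal (q +
      5) + 1 - 3 - (q + 2) = 1.\<close>
    unfolding nmds_def
    by (intro exI[of _ 3] exI[of _ "q + 2"] conjI code) (simp_all add: singleton_defect_def)
  moreover have "weight_enumerator (q + 5) C =
           1 + monom ((2 * of_nat q + 2) * (of_nat q - 1)) (q + 2)
             + monom ((of_nat q - 1) * ((of_nat q)\<^sup>2 - 3 * of_nat q + 8) / 2) (q + 3)
             + monom ((3 * of_nat q - 9) * (of_nat q - 1)) (q + 4)
             + monom ((of_nat q - 1) * ((of_nat q)\<^sup>2 - 5 * of_nat q + 8) / 2) (q + 5)" if "q mod 4 = 1"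
    \<comment> \<open>Here n = 0.\<close>
    unfolding enum num_sqrts_uminus(1)[OF two w, folded q, OF that]
    by (intro arg_cong2[where f = "(+)"] arg_cong2[where f = monom] refl) (simp_all add: field_simps)
  moreover have "weight_enumerator (q + 5) C =
           1 + monom ((2 * of_nat q + 1) * (of_nat q - 1)) (q + 2)
             + monom ((of_nat q - 1) * ((of_nat q)\<^sup>2 - 3 * of_nat q + 14) / 2) (q + 3)
             + monom ((3 * of_nat q - 12) * (of_nat q - 1)) (q + 4)
             + monom ((of_nat q - 1) * ((of_nat q)\<^sup>2 - 5 * of_nat q + 10) / 2) (q + 5)" if "q mod 4 = 3"
    \<comment> \<open>Here n = 2, which accounts for all differences from the other case.\<close>
    unfolding enum num_sqrts_uminus(2)[OF two w, folded q, OF that]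
    by (intro arg_cong2[where f = "(+)"] arg_cong2[where f = monom] refl) (simp_all add: field_simps)
  ultimately show ?thesis
    using code(1) by blast
qed

end
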